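(* For every finite simple graph $G$ on the vertex set $[n]$ with Laplacian $L_G$, $$\det\bigl(I+\operatorname{diag}(t_1,\dots,t_n)\,L_G\bigr)\in\mathcal{LC}_n .$$
   Context: $[n]=\{1,\dots,n\}$. The squarefree algebra $\mathcal{A}_n:=\mathbb{R}[t_1,\dots,t_n]/(t_1^2,\dots,t_n^2)$ has basis $\{t^S: S\subseteq[n]\}$ with $t^S:=\prod_{i\in S}t_i$, $t^\varnothing=1$; write $f=\sum_{S\subseteq[n]}f_S t^S$ with $f_S\in\mathbb{R}$. The determinant is computed over the commutative ring $\mathcal{A}_n$. The Laplacian is $L_G=$ (diagonal degree matrix) $-$ (adjacency matrix). For $f\in\mathcal{A}_n$ with $f_\varnothing=1$, define $\log f:=\sum_{k=1}^n\frac{(-1)^{k+1}}{k}(f-1)^k=\sum_{\varnothing\ne S\subseteq[n]}\kappa_S(f)\,t^S$. $\mathcal{LC}_n$ is the set of $f\in\mathcal{A}_n$ with $f_S\ge0$ for all $S\subseteq[n]$, $f_\varnothing=1$, and $\kappa_S(f)\le0$ for all $S\subseteq[n]$ with $|S|\ge2$. *)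

theory Defs
  imports "HOL-Analysis.Analysis" "HOL-Library.Poly_Mapping"
begin

section \<open>The squarefree algebra\<close>

text \<open>
  A real polynomial in variables indexed by a finite type is a finitely supported map from
  exponent vectors to coefficients.  The index type \<^typ>\<open>'n\<close> plays the role of \<open>{1, \<dots>, n}\<close>, with
  \<open>n = CARD('n)\<close>; \<open>'n sqfree\<close> below is the quotient of the polynomial ring by the ideal
  generated by the squares of the variables.
\<close>

type_synonym 'n rpoly = "('n \<Rightarrow>\<^sub>0 nat) \<Rightarrow>\<^sub>0 real"

definition rpoly_var :: "'n \<Rightarrow> 'n rpoly"
  where "rpoly_var i = Poly_Mapping.single (Poly_Mapping.single i 1) 1"

lemma rpoly_var_square: "rpoly_var i ^ 2 = Poly_Mapping.single (Poly_Mapping.single i 2) 1"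
  by (simp add: rpoly_var_def power2_eq_square mult_single numeral_2_eq_2 flip: single_add)

definition square_ideal :: "('n::finite) rpoly set"
  where "square_ideal = {\<Sum>i\<in>UNIV. p i * rpoly_var i ^ 2 | p. True}"

lemma square_ideal_zero: "0 \<in> square_ideal"
  unfolding square_ideal_def by (force intro: exI[of _ "\<lambda>_. 0"])

lemma square_ideal_add:
  assumes "a \<in> square_ideal" "b \<in> square_ideal"
  shows "a + b \<in> square_ideal"
proof -
  obtain p q where "a = (\<Sum>i\<in>UNIV. p i * rpoly_var i ^ 2)" "b = (\<Sum>i\<in>UNIV. q i * rpoly_var i ^ 2)"
    using assms unfolding square_ideal_def by blast
  then have "a + b = (\<Sum>i\<in>UNIV. (p i + q i) * rpoly_var i ^ 2)"
    by (simp add: sum.distrib distrib_right)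
  then show ?thesis
    unfolding square_ideal_def by (intro CollectI exI[of _ "\<lambda>i. p i + q i"]) simp
qed

lemma square_ideal_mult:
  assumes "a \<in> square_ideal"
  shows "r * a \<in> square_ideal"
proof -
  obtain p where "a = (\<Sum>i\<in>UNIV. p i * rpoly_var i ^ 2)"
    using assms unfolding square_ideal_def by blast
  then have "r * a = (\<Sum>i\<in>UNIV. (r * p i) * rpoly_var i ^ 2)"
    by (simp add: sum_distrib_left mult.assoc)
  then show ?thesis
    unfolding square_ideal_def by (intro CollectI exI[of _ "\<lambda>i. r * p i"]) simp
qed

lemma square_ideal_uminus: "a \<in> square_ideal \<Longrightarrow> - a \<in> square_ideal"
  using square_ideal_mult[of a "-1"] by simp

lemma square_ideal_gen: "p * rpoly_var i ^ 2 \<in> square_ideal"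
proof -
  have "p * rpoly_var i ^ 2 = (\<Sum>j\<in>UNIV. (if j = i then p else 0) * rpoly_var j ^ 2)"
    by (simp add: if_distrib[of "\<lambda>x. x * _"] cong: if_cong)
  then show ?thesis
    unfolding square_ideal_def by (intro CollectI exI[of _ "\<lambda>j. if j = i then p else 0"]) simp
qed

definition sq_exponent :: "('n::finite) set \<Rightarrow> 'n \<Rightarrow>\<^sub>0 nat"
  where "sq_exponent S = (\<Sum>i\<in>S. Poly_Mapping.single i 1)"

lemma lookup_sq_exponent: "Poly_Mapping.lookup (sq_exponent S) i = (if i \<in> S then 1 else 0)"
  by (simp add: sq_exponent_def lookup_sum lookup_single when_def)

lemma lookup_square_ideal:
  assumes "a \<in> square_ideal"
  shows "Poly_Mapping.lookup a (sq_exponent S) = 0"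
proof -
  obtain p where a: "a = (\<Sum>i\<in>UNIV. p i * rpoly_var i ^ 2)"
    using assms unfolding square_ideal_def by blast
  have ne: "sq_exponent S \<noteq> q + Poly_Mapping.single i 2" for q i
  proof
    assume "sq_exponent S = q + Poly_Mapping.single i 2"
    then have "Poly_Mapping.lookup (sq_exponent S) i = Poly_Mapping.lookup q i + 2"
      by (simp add: lookup_add)
    then show False by (simp add: lookup_sq_exponent split: if_splits)
  qed
  have "Poly_Mapping.lookup (p i * rpoly_var i ^ 2) (sq_exponent S) = 0" for i
  proof -
    have "(Poly_Mapping.lookup (rpoly_var i ^ 2) q when sq_exponent S = l + q) = 0" for l q
      using ne by (auto simp: rpoly_var_square lookup_single when_def)
    then show ?thesis by (simp add: lookup_mult)
  qed
  then show ?thesis by (simp add: a lookup_sum)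
qed

quotient_type (overloaded) 'n sqfree = "('n::finite) rpoly" / "\<lambda>p q. p - q \<in> square_ideal"
proof (rule equivpI)
  show "reflp (\<lambda>p q::'n rpoly. p - q \<in> square_ideal)"
    by (simp add: reflp_def square_ideal_zero)
  show "symp (\<lambda>p q::'n rpoly. p - q \<in> square_ideal)"
    by (rule sympI) (metis square_ideal_uminus minus_diff_eq)
  show "transp (\<lambda>p q::'n rpoly. p - q \<in> square_ideal)"
    by (rule transpI) (drule (1) square_ideal_add, simp)
qed

lemma square_ideal_eqI: "p = q \<Longrightarrow> p - q \<in> square_ideal"
  by (simp add: square_ideal_zero)

instantiation sqfree :: (finite) "{comm_ring_1, real_algebra_1}"
begin

lift_definition zero_sqfree :: "'a sqfree" is 0 .

lift_definition one_sqfree :: "'a sqfree" is 1 .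

lift_definition plus_sqfree :: "'a sqfree \<Rightarrow> 'a sqfree \<Rightarrow> 'a sqfree" is "(+)"
  by (drule (1) square_ideal_add, simp add: algebra_simps)

lift_definition uminus_sqfree :: "'a sqfree \<Rightarrow> 'a sqfree" is uminus
  by (drule square_ideal_uminus) (simp add: algebra_simps)

lift_definition minus_sqfree :: "'a sqfree \<Rightarrow> 'a sqfree \<Rightarrow> 'a sqfree" is "(-)"
proof -
  fix p p' q q' :: "'a rpoly"
  assume "p - p' \<in> square_ideal" "q - q' \<in> square_ideal"
  then have "(p - p') + - (q - q') \<in> square_ideal"
    by (intro square_ideal_add square_ideal_uminus)
  then show "p - q - (p' - q') \<in> square_ideal"
    by (simp add: algebra_simps)
qed

lift_definition times_sqfree :: "'a sqfree \<Rightarrow> 'a sqfree \<Rightarrow> 'a sqfree" is "(*)"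
proof -
  fix p p' q q' :: "'a rpoly"
  assume "p - p' \<in> square_ideal" "q - q' \<in> square_ideal"
  then have "q * (p - p') + p' * (q - q') \<in> square_ideal"
    by (intro square_ideal_add square_ideal_mult)
  then show "p * q - p' * q' \<in> square_ideal"
    by (simp add: algebra_simps)
qed

lift_definition scaleR_sqfree :: "real \<Rightarrow> 'a sqfree \<Rightarrow> 'a sqfree"
  is "\<lambda>c p. Poly_Mapping.single 0 c * p"
  by (metis square_ideal_mult right_diff_distrib)

instance
proof
  fix a b c :: "'a sqfree" and r s :: real
  have assoc: "Poly_Mapping.single 0 r * (Poly_Mapping.single 0 s * p)
      = Poly_Mapping.single 0 (r * s) * p" for r s and p :: "'a rpoly"
    by (simp add: mult_single flip: mult.assoc)
  show "a * b * c = a * (b * c)"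
    by transfer (simp add: square_ideal_zero mult.assoc)
  show "a * b = b * a"
    by transfer (simp add: square_ideal_zero mult.commute)
  show "1 * a = a"
    by transfer (simp add: square_ideal_zero)
  show "(a + b) * c = a * c + b * c"
    by transfer (simp add: square_ideal_zero distrib_right)
  show "a + b + c = a + (b + c)"
    by transfer (simp add: square_ideal_zero add.assoc)
  show "a + b = b + a"
    by transfer (simp add: square_ideal_zero add.commute)
  show "a * (b + c) = a * b + a * c"
    by transfer (simp add: square_ideal_zero distrib_left)
  show "a * 1 = a"
    by transfer (simp add: square_ideal_zero)
  show "0 + a = a"
    by transfer (simp add: square_ideal_zero)
  show "- a + a = 0"
    by transfer (simp add: square_ideal_zero)
  show "a - b = a + - b"
    by transfer (simp add: square_ideal_zero)
  show "(0 :: 'a sqfree) \<noteq> 1"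
  proof transfer
    have "Poly_Mapping.lookup (0 - 1 :: 'a rpoly) (sq_exponent {}) \<noteq> 0"
      by (simp add: sq_exponent_def)
    then show "(0 :: 'a rpoly) - 1 \<notin> square_ideal"
      using lookup_square_ideal by blast
  qed
  show "r *\<^sub>R (a + b) = r *\<^sub>R a + r *\<^sub>R b"
    by transfer (simp add: square_ideal_zero distrib_left)
  show "(r + s) *\<^sub>R a = r *\<^sub>R a + s *\<^sub>R a"
    by transfer (simp add: square_ideal_zero single_add distrib_right)
  show "r *\<^sub>R s *\<^sub>R a = (r * s) *\<^sub>R a"
    by transfer (simp add: square_ideal_zero assoc)
  show "1 *\<^sub>R a = a"
    by transfer (simp add: square_ideal_zero)
  show "r *\<^sub>R a * b = r *\<^sub>R (a * b)"
    by transfer (simp add: square_ideal_zero mult.assoc)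
  show "a * r *\<^sub>R b = r *\<^sub>R (a * b)"
    by transfer (rule square_ideal_eqI, simp add: mult.left_commute)
qed

end

lift_definition sqvar :: "('n::finite) \<Rightarrow> 'n sqfree" is rpoly_var .

definition sqmon :: "('n::finite) set \<Rightarrow> 'n sqfree"
  where "sqmon S = (\<Prod>i\<in>S. sqvar i)"

text \<open>
  The coordinate \<open>f\<^sub>S\<close> is read off from any representative polynomial.  The lemmas
  \<open>sqcoeff_sqmon\<close> and \<open>sqfree_expansion\<close> say that the \<open>sqmon S\<close> form a basis with these coordinates.
\<close>

lift_definition sqcoeff :: "('n::finite) sqfree \<Rightarrow> 'n set \<Rightarrow> real"
  is "\<lambda>p S. Poly_Mapping.lookup p (sq_exponent S)"
proof -
  fix p q :: "'n rpoly" assume "p - q \<in> square_ideal"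
  then show "(\<lambda>S. Poly_Mapping.lookup p (sq_exponent S)) = (\<lambda>S. Poly_Mapping.lookup q (sq_exponent S))"
    using lookup_square_ideal[of "p - q"] by (simp add: lookup_minus fun_eq_iff)
qed

lemma sqcoeff_add: "sqcoeff (f + g) S = sqcoeff f S + sqcoeff g S"
  by transfer (simp add: lookup_add)

lemma sqcoeff_scaleR: "sqcoeff (c *\<^sub>R f) S = c * sqcoeff f S"
proof -
  have "Poly_Mapping.lookup (Poly_Mapping.single 0 c * p) k = c * Poly_Mapping.lookup p k"
    for p :: "'a rpoly" and k
    unfolding mult_map_scale_conv_mult[symmetric] Poly_Mapping.map.rep_eq by (simp add: when_def)
  then show ?thesis by transfer
qed

lemma sqmon_transfer:
  "sqmon S = abs_sqfree (Poly_Mapping.single (sq_exponent S) 1)"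
proof -
  have "finite S" by simp
  then show ?thesis
  proof induction
    case empty
    then show ?case by (simp add: sqmon_def sq_exponent_def one_sqfree.abs_eq)
  next
    case (insert i S)
    then show ?case
      by (simp add: sqmon_def sq_exponent_def sqvar.abs_eq rpoly_var_def times_sqfree.abs_eq
          mult_single)
  qed
qed

lemma sqcoeff_sqmon: "sqcoeff (sqmon S) T = (if S = T then 1 else 0)"
proof -
  have "S = T" if eq: "sq_exponent S = sq_exponent T"
  proof (rule set_eqI)
    fix i
    have "(if i \<in> S then 1 else 0 :: nat) = (if i \<in> T then 1 else 0)"
      unfolding lookup_sq_exponent[symmetric] eq by (rule refl)
    then show "i \<in> S \<longleftrightarrow> i \<in> T"
      by (cases "i \<in> S"; cases "i \<in> T"; simp)
  qed
  then have "sq_exponent S = sq_exponent T \<longleftrightarrow> S = T"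
    by blast
  then show ?thesis
    by (simp add: sqmon_transfer sqcoeff.abs_eq lookup_single when_def)
qed

lemma sqfree_expansion: "f = (\<Sum>S\<in>UNIV. sqcoeff f S *\<^sub>R sqmon S)"
proof -
  let ?E = "\<lambda>f::'a sqfree. \<Sum>S\<in>UNIV. sqcoeff f S *\<^sub>R sqmon S"
  have E_add: "?E (f + g) = ?E f + ?E g" for f g
    by (simp add: sqcoeff_add scaleR_add_left sum.distrib)
  have mono: "abs_sqfree (Poly_Mapping.single k c) = ?E (abs_sqfree (Poly_Mapping.single k c))"
    (is "?m = _") for k :: "'a \<Rightarrow>\<^sub>0 nat" and c
  proof (cases "\<exists>i. Poly_Mapping.lookup k i \<ge> 2")
    case True
    then obtain i where i: "Poly_Mapping.lookup k i \<ge> 2" by blast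
    have "k = (k - Poly_Mapping.single i 2) + Poly_Mapping.single i 2"
      using i by (intro poly_mapping_eqI) (auto simp: lookup_add lookup_minus lookup_single when_def)
    then have "Poly_Mapping.single k c
        = Poly_Mapping.single (k - Poly_Mapping.single i 2) c * rpoly_var i ^ 2"
      by (simp add: rpoly_var_square mult_single)
    then have "?m = 0"
      by (simp add: zero_sqfree_def sqfree.abs_eq_iff square_ideal_gen)
    moreover have "sqcoeff 0 S = 0" for S :: "'a set"
      by transfer simp
    ultimately show ?thesis by simp
  next
    case False
    define S where "S = {i. Poly_Mapping.lookup k i = 1}"
    have "Poly_Mapping.lookup k i = (if i \<in> S then 1 else 0)" for i
    proof -
      have "Poly_Mapping.lookup k i < 2" using False by (simp add: not_le)
      then show ?thesis by (auto simp: S_def)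
    qed
    then have k: "k = sq_exponent S"
      by (intro poly_mapping_eqI) (simp add: lookup_sq_exponent)
    have m: "?m = c *\<^sub>R sqmon S"
      by (simp add: k sqmon_transfer scaleR_sqfree.abs_eq mult_single)
    have "sqcoeff ?m T *\<^sub>R sqmon T = (if T = S then ?m else 0)" for T
      by (auto simp: m sqcoeff_scaleR sqcoeff_sqmon)
    then show ?thesis by simp
  qed
  have "abs_sqfree p = ?E (abs_sqfree p)" for p :: "'a rpoly"
  proof (induction p rule: update_induct)
    case const
    then show ?case using mono[of 0 0] by simp
  next
    case (update p k c)
    have "Poly_Mapping.update k c p = p + Poly_Mapping.single k c"
      using update by (intro poly_mapping_eqI)
        (auto simp: lookup_update lookup_add lookup_single when_def in_keys_iff)
    then show ?case
      using update mono[of k c] by (simp add: E_add flip: plus_sqfree.abs_eq)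
  qed
  then show ?thesis by (rule sqfree.abs_induct[of "\<lambda>f. f = ?E f"])
qed

section \<open>Logarithm and the class \<open>\<L>\<C>\<^sub>n\<close>\<close>

text \<open>Meaningful for \<^term>\<open>sqcoeff f {} = 1\<close> only.\<close>

definition sqlog :: "('n::finite) sqfree \<Rightarrow> 'n sqfree"
  where "sqlog f = (\<Sum>k=1..CARD('n). ((-1) ^ (k + 1) / real k) *\<^sub>R (f - 1) ^ k)"

definition sqcumulant :: "('n::finite) set \<Rightarrow> 'n sqfree \<Rightarrow> real"
  where "sqcumulant S f = sqcoeff (sqlog f) S"

definition LC :: "('n::finite) sqfree set"
  where "LC = {f. (\<forall>S. sqcoeff f S \<ge> 0) \<and> sqcoeff f {} = 1 \<and>
    (\<forall>S. card S \<ge> 2 \<longrightarrow> sqcumulant S f \<le> 0)}"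

section \<open>Graphs and Laplacians\<close>

text \<open>A simple graph on the vertex set \<^typ>\<open>'n\<close> is given by its adjacency relation.\<close>

definition simple_graph :: "('n \<Rightarrow> 'n \<Rightarrow> bool) \<Rightarrow> bool"
  where "simple_graph E \<longleftrightarrow> symp E \<and> irreflp E"

definition diag_matrix :: "('n \<Rightarrow> 'a::zero) \<Rightarrow> 'a ^ 'n ^ 'n"
  where "diag_matrix d = (\<chi> i j. if i = j then d i else 0)"

definition adjacency_matrix :: "('n::finite \<Rightarrow> 'n \<Rightarrow> bool) \<Rightarrow> real ^ 'n ^ 'n"
  where "adjacency_matrix E = (\<chi> i j. if E i j then 1 else 0)"

definition vertex_degree :: "('n::finite \<Rightarrow> 'n \<Rightarrow> bool) \<Rightarrow> 'n \<Rightarrow> nat"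
  where "vertex_degree E i = card {j. E i j}"

definition laplacian :: "('n::finite \<Rightarrow> 'n \<Rightarrow> bool) \<Rightarrow> real ^ 'n ^ 'n"
  where "laplacian E = diag_matrix (\<lambda>i. real (vertex_degree E i)) - adjacency_matrix E"

text \<open>Entrywise embedding of a real matrix into the matrices over a real algebra.\<close>

definition of_real_matrix :: "real ^ 'n ^ 'm \<Rightarrow> 'a::real_algebra_1 ^ 'n ^ 'm"
  where "of_real_matrix A = (\<chi> i j. of_real (A $ i $ j))"

end

theory Submission
  imports Defs
begin

text \<open>
  Put \<open>M = I + diag(t) L\<close>. The coefficient of \<open>t\<^sup>S\<close> in \<open>f = det M\<close> is the principal minor of \<open>L\<close> on
  \<open>S\<close>, which is nonnegative because \<open>L\<close> is positive semidefinite. For the cumulants fix \<open>i \<in> S\<close>.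
  Row \<open>i\<close> of \<open>M\<close> is \<open>e\<^sub>i + t\<^sub>i L\<^sub>i\<close>, so \<open>f = a + t\<^sub>i b\<close> with \<open>a\<close>, \<open>b\<close> free of \<open>t\<^sub>i\<close>; as
  \<open>\<partial>\<^sub>i log f = \<partial>\<^sub>i f / f\<close>, the cumulant \<open>\<kappa>\<^sub>S(f)\<close>
  is the coefficient of \<open>t\<close> to the power \<open>S - {i}\<close> in \<open>b / a\<close>. Writing \<open>R\<^sub>l\<close> for the cofactor of
  \<open>M\<close> at \<open>(i, l)\<close> divided by \<open>a\<close>, one has \<open>b / a = \<Sum>\<^sub>l L\<^sub>i\<^sub>l R\<^sub>l\<close>, \<open>R\<^sub>i = 1\<close>, and
  \<open>R\<^sub>j = - t\<^sub>j \<Sum>\<^sub>l L\<^sub>j\<^sub>l R\<^sub>l\<close> for \<open>j \<noteq> i\<close>. As \<open>t\<^sub>j\<^sup>2 = 0\<close>, the diagonal term of this sum drops out, so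
  by induction all coefficients of \<open>R\<^sub>j\<close> are nonnegative, and those of \<open>b / a\<close> are nonpositive
  apart from the constant one.
\<close>

section \<open>Coefficient calculus in the squarefree algebra\<close>

lemma sqcoeff_zero [simp]: "sqcoeff 0 S = 0"
  using sqcoeff_scaleR[of 0 0 S] by simp

lemma sqcoeff_uminus: "sqcoeff (- f) S = - sqcoeff f S"
  using sqcoeff_scaleR[of "-1" f S] by simp

lemma sqcoeff_diff: "sqcoeff (f - g) S = sqcoeff f S - sqcoeff g S"
  using sqcoeff_add[of f "- g" S] by (simp add: sqcoeff_uminus)

lemma sqcoeff_sum: "sqcoeff (sum f A) S = (\<Sum>x\<in>A. sqcoeff (f x) S)"
  by (induction A rule: infinite_finite_induct) (simp_all add: sqcoeff_add)

lemma sqcoeff_of_real_mult: "sqcoeff (of_real c * f) S = c * sqcoeff f S"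
  by (simp add: sqcoeff_scaleR of_real_def)

lemma sqcoeff_of_int_mult: "sqcoeff (of_int z * f) S = of_int z * sqcoeff f S"
  using sqcoeff_of_real_mult[of "of_int z" f S] by simp

lemma sqcoeff_of_nat_mult: "sqcoeff (of_nat n * f) S = of_nat n * sqcoeff f S"
  using sqcoeff_of_real_mult[of "of_nat n" f S] by simp

lemma sqcoeff_one: "sqcoeff 1 S = (if S = {} then 1 else 0)"
  using sqcoeff_sqmon[of "{}" S] by (auto simp: sqmon_def)

lemma sqvar_square: "sqvar i * sqvar i = 0"
proof -
  have "rpoly_var i * rpoly_var i - 0 \<in> square_ideal"
    using square_ideal_gen[of 1 i] by (simp add: power2_eq_square)
  then show ?thesis
    by transfer
qed

lemma sqmon_mult: "sqmon S * sqmon T = (if S \<inter> T = {} then sqmon (S \<union> T) else 0)"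
proof (cases "S \<inter> T = {}")
  case True
  then show ?thesis
    by (simp add: sqmon_def prod.union_disjoint)
next
  case False
  then obtain i where i: "i \<in> S" "i \<in> T" by blast
  have "sqmon S * sqmon T
      = (sqvar i * sqvar i) * ((\<Prod>j\<in>S - {i}. sqvar j) * (\<Prod>j\<in>T - {i}. sqvar j))"
    using i by (simp add: sqmon_def prod.remove[of S i] prod.remove[of T i] mult_ac)
  with False show ?thesis
    by (simp add: sqvar_square)
qed

text \<open>Monomials sharing a variable multiply to zero, so only complementary pairs inside
  \<open>S\<close> survive.\<close>

lemma sqcoeff_mult: "sqcoeff (f * g) S = (\<Sum>T\<in>Pow S. sqcoeff f T * sqcoeff g (S - T))"
proof -
  have "f * g = (\<Sum>T\<in>UNIV. \<Sum>U\<in>UNIV. (sqcoeff f T * sqcoeff g U) *\<^sub>R (sqmon T * sqmon U))"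
    (is "_ = ?r")
  proof -
    have "f * g = (\<Sum>T\<in>UNIV. sqcoeff f T *\<^sub>R sqmon T) * (\<Sum>U\<in>UNIV. sqcoeff g U *\<^sub>R sqmon U)"
      by (simp flip: sqfree_expansion)
    also have "\<dots> = ?r"
      by (simp add: sum_product mult.commute)
    finally show ?thesis .
  qed
  then have "sqcoeff (f * g) S
      = (\<Sum>T\<in>UNIV. \<Sum>U\<in>UNIV. sqcoeff f T * sqcoeff g U * sqcoeff (sqmon T * sqmon U) S)"
    by (simp add: sqcoeff_sum sqcoeff_scaleR)
  also have "\<dots> = (\<Sum>T\<in>UNIV. \<Sum>U\<in>UNIV.
      if T \<subseteq> S \<and> U = S - T then sqcoeff f T * sqcoeff g U else 0)"
    by (intro sum.cong refl) (auto simp: sqmon_mult sqcoeff_sqmon)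
  also have "\<dots> = (\<Sum>T\<in>UNIV. if T \<subseteq> S then sqcoeff f T * sqcoeff g (S - T) else 0)"
    by (intro sum.cong refl) auto
  also have "\<dots> = (\<Sum>T\<in>Pow S. sqcoeff f T * sqcoeff g (S - T))"
    by (rule sum.mono_neutral_cong_right) auto
  finally show ?thesis .
qed

lemma sqcoeff_sqvar_mult: "sqcoeff (sqvar i * f) S = (if i \<in> S then sqcoeff f (S - {i}) else 0)"
proof -
  have "sqcoeff (sqvar i) T = (if T = {i} then 1 else 0)" for T
    using sqcoeff_sqmon[of "{i}" T] by (auto simp: sqmon_def)
  then have "sqcoeff (sqvar i * f) S = (\<Sum>T\<in>Pow S. if T = {i} then sqcoeff f (S - {i}) else 0)"
    unfolding sqcoeff_mult by (intro sum.cong refl) auto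
  then show ?thesis
    by simp
qed

section \<open>Powers, nilpotency and the logarithm\<close>

text \<open>As \<open>g\<close> has no constant term, a contribution to \<open>g ^ k\<close> at
  \<open>S\<close> splits \<open>S\<close> into \<open>k\<close> nonempty blocks.\<close>

lemma sqcoeff_power_eq_0_if_card_less:
  assumes "sqcoeff g {} = 0" "card S < k"
  shows "sqcoeff (g ^ k) S = 0"
  using assms(2)
proof (induction k arbitrary: S)
  case (Suc k)
  have "sqcoeff g T * sqcoeff (g ^ k) (S - T) = 0" if "T \<subseteq> S" for T
  proof (cases "T = {}")
    case False
    then have "0 < card T" "card T \<le> card S"
      using that by (auto simp: card_gt_0_iff intro: card_mono)
    then have "card (S - T) < k"
      using Suc.prems that by (simp add: card_Diff_subset)
    then show ?thesis
      using Suc.IH by simp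
  qed (simp add: assms(1))
  then show ?case
    by (auto simp: sqcoeff_mult intro: sum.neutral)
qed simp

lemma sqcoeff_power_eq_0_if_mem:
  assumes "\<And>T. i \<in> T \<Longrightarrow> sqcoeff g T = 0" "i \<in> S"
  shows "sqcoeff (g ^ k) S = 0"
  using assms(2)
proof (induction k arbitrary: S)
  case 0
  then show ?case by (auto simp: sqcoeff_one)
next
  case (Suc k)
  have "sqcoeff g T * sqcoeff (g ^ k) (S - T) = 0" for T
    using assms(1)[of T] Suc.IH[of "S - T"] Suc.prems by (cases "i \<in> T") auto
  then show ?case
    by (auto simp: sqcoeff_mult intro: sum.neutral)
qed

lemma sqfree_eqI: "(\<And>S. sqcoeff f S = sqcoeff g S) \<Longrightarrow> f = g"
  by (subst sqfree_expansion[of f], subst sqfree_expansion[of g]) simp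

text \<open>The binomial expansion stops after the linear term because \<open>sqvar i\<close>
  squares to zero.\<close>

lemma power_add_sqvar_mult:
  "(g + sqvar i * b) ^ k = g ^ k + of_nat k * (sqvar i * (b * g ^ (k - 1)))"
proof (induction k)
  case (Suc k)
  have "(g + sqvar i * b) ^ Suc k
      = g * g ^ k + sqvar i * (b * g ^ k) + of_nat k * (sqvar i * (b * (g * g ^ (k - 1))))
        + (sqvar i * sqvar i) * (b * of_nat k * (b * g ^ (k - 1)))"
    by (simp only: power_Suc Suc.IH) (simp only: algebra_simps)
  \<comment> \<open>At \<open>k = 0\<close> the truncated \<open>k - 1\<close> is harmless: both
    sides vanish.\<close>
  moreover have "of_nat k * (g * g ^ (k - 1)) = of_nat k * g ^ k"
    by (cases k) simp_all
  then have "of_nat k * (sqvar i * (b * (g * g ^ (k - 1)))) = of_nat k * (sqvar i * (b * g ^ k))"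
    by (metis mult.left_commute)
  ultimately show ?case
    by (simp add: sqvar_square algebra_simps)
qed simp

text \<open>\<open>c\<close> is the inverse of \<open>a\<close>, fixed before \<open>S\<close> and
  \<open>b\<close>. The variable \<open>sqvar i\<close> may occur in \<open>b\<close>; the
  coefficient at \<open>S - {i}\<close> does not see it.\<close>

lemma sqcumulant_split:
  fixes a :: "'n::finite sqfree"
  assumes a0: "sqcoeff a {} = 1" and ai: "\<And>T. i \<in> T \<Longrightarrow> sqcoeff a T = 0"
  obtains c where "a * c = 1"
    "\<And>S b. i \<in> S \<Longrightarrow> sqcumulant S (a + sqvar i * b) = sqcoeff (b * c) (S - {i})"
proof
  define g where "g = a - 1"
  \<comment> \<open>Geometric series for 1 / (1 + g), finite because the power
    \<open>CARD('n)\<close> of \<open>- g\<close> vanishes.\<close>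
  define c where "c = (\<Sum>k<CARD('n). (- g) ^ k)"
  have g0: "sqcoeff g {} = 0"
    by (simp add: g_def sqcoeff_diff a0 sqcoeff_one)
  have gi: "sqcoeff g T = 0" if "i \<in> T" for T
    using that by (auto simp: g_def sqcoeff_diff ai sqcoeff_one)
  \<comment> \<open>Only \<open>UNIV\<close> has \<open>CARD('n)\<close> elements, and it contains
    \<open>i\<close>, which never occurs in \<open>g\<close>.\<close>
  have "sqcoeff ((- g) ^ CARD('n)) S = 0" for S
  proof (cases "S = UNIV")
    case True
    then show ?thesis
      by (intro sqcoeff_power_eq_0_if_mem[where i = i]) (auto simp: sqcoeff_uminus gi)
  next
    case False
    then have "card S < CARD('n)"
      by (intro psubset_card_mono) auto
    then show ?thesis
      by (intro sqcoeff_power_eq_0_if_card_less) (auto simp: sqcoeff_uminus g0)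
  qed
  then have nil: "(- g) ^ CARD('n) = 0"
    by (intro sqfree_eqI) simp
  have "1 - (- g) ^ CARD('n) = (1 - (- g)) * c"
    unfolding c_def by (rule one_diff_power_eq)
  then show "a * c = 1"
    using nil by (simp add: g_def)
  fix S and b :: "'n sqfree" assume i: "i \<in> S"
  \<comment> \<open>The factor \<open>k\<close> of the linear term cancels the 1 / k of the
    logarithm; the alternating sign turns \<open>g\<close> into \<open>- g\<close>.\<close>
  have summand: "sqcoeff (((-1) ^ (k + 1) / real k) *\<^sub>R (a + sqvar i * b - 1) ^ k) S
      = sqcoeff (b * (- g) ^ (k - 1)) (S - {i})" if "k \<ge> 1" for k
  proof -
    have shift: "a + sqvar i * b - 1 = g + sqvar i * b"
      by (simp add: g_def)
    have "sqcoeff ((a + sqvar i * b - 1) ^ k) S = real k * sqcoeff (b * g ^ (k - 1)) (S - {i})"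
      unfolding shift
      using i sqcoeff_power_eq_0_if_mem[OF gi i]
      by (simp add: power_add_sqvar_mult sqcoeff_add sqcoeff_sqvar_mult sqcoeff_of_nat_mult)
    moreover have "b * (- g) ^ (k - 1) = ((-1) ^ (k + 1)) *\<^sub>R (b * g ^ (k - 1))"
      using that by (cases k) (auto simp: power_minus[of g] scaleR_conv_of_real)
    ultimately show ?thesis
      using that by (simp add: sqcoeff_scaleR sqcoeff_uminus)
  qed
  have "sqcumulant S (a + sqvar i * b)
      = (\<Sum>k=1..CARD('n). sqcoeff (b * (- g) ^ (k - 1)) (S - {i}))"
    unfolding sqcumulant_def sqlog_def sqcoeff_sum by (intro sum.cong refl summand) simp
  also have "\<dots> = (\<Sum>k<CARD('n). sqcoeff (b * (- g) ^ k) (S - {i}))"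
    by (rule sum.reindex_bij_witness[of _ Suc "\<lambda>k. k - 1"]) auto
  also have "\<dots> = sqcoeff (b * c) (S - {i})"
    by (simp add: c_def sum_distrib_left sqcoeff_sum)
  finally show "sqcumulant S (a + sqvar i * b) = sqcoeff (b * c) (S - {i})" .
qed

section \<open>Determinants with rows affine in the variables\<close>

lemma sqcoeff_prod_affine:
  assumes "finite I"
  shows "sqcoeff (\<Prod>j\<in>I. of_real (u j) + sqvar j * of_real (v j)) S
    = (if S \<subseteq> I then \<Prod>j\<in>I. if j \<in> S then v j else u j else 0)"
  using assms
proof (induction I arbitrary: S rule: finite_induct)
  case (insert j I)
  define P where "P = (\<Prod>j\<in>I. of_real (u j) + sqvar j * of_real (v j))"
  have "sqcoeff ((of_real (u j) + sqvar j * of_real (v j)) * P) S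
      = u j * sqcoeff P S + v j * (if j \<in> S then sqcoeff P (S - {j}) else 0)"
    by (simp add: distrib_right sqcoeff_add sqcoeff_of_real_mult sqcoeff_sqvar_mult mult.assoc)
  moreover have "(\<Prod>k\<in>I. if k \<in> S - {j} then v k else u k) = (\<Prod>k\<in>I. if k \<in> S then v k else u k)"
    using insert.hyps by (intro prod.cong) auto
  moreover have "S - {j} \<subseteq> I \<longleftrightarrow> S \<subseteq> insert j I" "j \<notin> S \<Longrightarrow> S \<subseteq> insert j I \<longleftrightarrow> S \<subseteq> I"
    "j \<in> S \<Longrightarrow> \<not> S \<subseteq> I"
    using insert.hyps by auto
  ultimately show ?case
    using insert.hyps by (simp add: insert.IH flip: P_def) (simp add: P_def insert.IH)
qed (simp add: sqcoeff_one)

text \<open>Each Leibniz product takes one factor from every row, so extracting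
  \<open>sqmon S\<close> selects row \<open>j\<close> of \<open>V\<close> if \<open>j\<close> is in
  \<open>S\<close> and of \<open>U\<close> otherwise.\<close>

lemma sqcoeff_det_affine:
  fixes U V :: "real ^ 'n ^ 'n::finite"
  shows "sqcoeff (det (\<chi> j l. of_real (U $ j $ l) + sqvar j * of_real (V $ j $ l))) S
    = det (\<chi> j. if j \<in> S then V $ j else U $ j)"
  unfolding det_def sqcoeff_sum sqcoeff_of_int_mult
  by (simp add: sqcoeff_prod_affine if_distrib[of "\<lambda>x. x $ _"])

text \<open>Cofactor expansion along row \<open>i\<close>, a cofactor being the determinant with a
  unit vector in that row. As \<open>w\<close> is arbitrary, another row of the matrix can be
  inserted.\<close>

lemma det_row_expand:
  fixes w :: "'a::comm_ring_1 ^ 'n::finite"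
  shows "det (\<chi> j. if j = i then w else c j)
    = (\<Sum>l\<in>UNIV. w $ l * det (\<chi> j. if j = i then axis l 1 else c j))"
proof -
  have "det (\<chi> j. if j = i then w else c j)
      = det (\<chi> j. if j = i then \<Sum>l\<in>UNIV. w $ l *s axis l 1 else c j)"
    by (simp add: basis_expansion cong: if_cong)
  then show ?thesis
    by (simp add: det_linear_row_sum det_row_mul)
qed

section \<open>Signs of the cumulants\<close>

lemma sqcumulant_det_nonpos:
  fixes Q :: "real ^ 'n ^ 'n::finite"
  assumes Q: "\<And>j l. j \<noteq> l \<Longrightarrow> Q $ j $ l \<le> 0" and S: "card S \<ge> 2"
  shows "sqcumulant S (det (mat 1 + diag_matrix sqvar ** of_real_matrix Q)) \<le> 0"
proof -
  obtain i where i: "i \<in> S"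
    using S by fastforce
  define M :: "'n sqfree ^ 'n ^ 'n" where "M = mat 1 + diag_matrix sqvar ** of_real_matrix Q"
  define q :: "'n \<Rightarrow> 'n sqfree ^ 'n" where "q j = (\<chi> l. of_real (Q $ j $ l))" for j
  have M: "M $ j = axis j 1 + sqvar j *s q j" for j
    by (simp add: M_def q_def vec_eq_iff axis_def mat_def matrix_matrix_mult_def diag_matrix_def
        of_real_matrix_def if_distrib[of "\<lambda>x. x * _"] cong: if_cong)
  define C where "C l = det (\<chi> j. if j = i then axis l 1 else M $ j)" for l
  have expand: "det (\<chi> j. if j = i then w else M $ j) = (\<Sum>l\<in>UNIV. w $ l * C l)" for w
    unfolding C_def by (rule det_row_expand)
  \<comment> \<open>Row \<open>i\<close> in \<open>C i\<close> is constant, so its part linear in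
    the variables is the zero row. This supplies both hypotheses of
    \<open>sqcumulant_split\<close>.\<close>
  have C_coeff: "sqcoeff (C i) T = det (\<chi> j. if j \<in> T then if j = i then 0 else Q $ j else axis j 1)"
    for T
  proof -
    have "(\<chi> j. if j = i then axis i 1 else M $ j)
        = (\<chi> j l. of_real ((mat 1 :: real ^ 'n ^ 'n) $ j $ l)
            + sqvar j * of_real ((\<chi> j. if j = i then 0 else Q $ j) $ j $ l))"
      by (auto simp: vec_eq_iff M q_def axis_def mat_def)
    then have "sqcoeff (C i) T
        = det (\<chi> j. if j \<in> T then (\<chi> j. if j = i then 0 else Q $ j) $ j else mat 1 $ j)"
      unfolding C_def by (simp only: sqcoeff_det_affine)
    also have "\<dots> = det (\<chi> j. if j \<in> T then if j = i then 0 else Q $ j else axis j 1)"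
      by (rule arg_cong[where f = det]) (auto simp: vec_eq_iff mat_def axis_def)
    finally show ?thesis .
  qed
  have C_nil: "sqcoeff (C i) {} = 1"
  proof -
    have "(\<chi> j. axis j 1) = (mat 1 :: real ^ 'n ^ 'n)"
      by (auto simp: vec_eq_iff mat_def axis_def)
    then show ?thesis
      by (simp add: C_coeff)
  qed
  have C_mem: "sqcoeff (C i) T = 0" if "i \<in> T" for T
    unfolding C_coeff by (rule det_zero_row[of i]) (use that in \<open>simp_all add: row_def vec_eq_iff\<close>)
  obtain c where c: "C i * c = 1" and
    cumulant: "\<And>b. sqcumulant S (C i + sqvar i * b) = sqcoeff (b * c) (S - {i})"
    using sqcumulant_split[OF C_nil C_mem] i by metis
  define R where "R l = C l * c" for l
  have R_rec: "R j = - (sqvar j * (\<Sum>l\<in>UNIV. of_real (Q $ j $ l) * R l))" if "j \<noteq> i" for j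
  proof -
    \<comment> \<open>Copying row \<open>j\<close> into row \<open>i\<close> makes two rows equal;
      expanding along row \<open>i\<close> gives a linear relation between the cofactors.\<close>
    have "det (\<chi> k. if k = i then M $ j else M $ k) = 0"
      by (rule det_identical_rows[of i j]) (use that in \<open>auto simp: row_def vec_eq_iff\<close>)
    then have "0 = (\<Sum>l\<in>UNIV. M $ j $ l * C l) * c"
      by (simp add: expand)
    also have "\<dots> = (\<Sum>l\<in>UNIV. (if l = j then R l else 0) + sqvar j * (of_real (Q $ j $ l) * R l))"
      unfolding sum_distrib_right
      by (intro sum.cong refl) (simp add: M q_def axis_def R_def algebra_simps)
    also have "\<dots> = R j + sqvar j * (\<Sum>l\<in>UNIV. of_real (Q $ j $ l) * R l)"
      by (simp add: sum.distrib sum_distrib_left)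
    finally show ?thesis
      by (metis add_eq_0_iff2)
  qed
  have R_nonneg: "sqcoeff (R j) T \<ge> 0" for j T
  proof (induction "card T" arbitrary: j T rule: less_induct)
    case less
    show ?case
    proof (cases "j = i")
      case True
      then show ?thesis
        by (simp add: R_def c sqcoeff_one)
    next
      case False
      show ?thesis
      proof (cases "j \<in> T")
        case True
        \<comment> \<open>The sign of \<open>Q $ j $ j\<close> is unknown, but \<open>R j\<close> is
          a multiple of \<open>sqvar j\<close>, so its coefficient at \<open>T - {j}\<close> is
          0.\<close>
        have "Q $ j $ l * sqcoeff (R l) (T - {j}) \<le> 0" for l
        proof (cases "l = j")
          case True
          then show ?thesis
            by (subst R_rec) (use False in \<open>simp_all add: sqcoeff_uminus sqcoeff_sqvar_mult\<close>)
        next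
          case l: False
          have "card (T - {j}) < card T"
            using True by (intro psubset_card_mono) auto
          then show ?thesis
            using less[of "T - {j}" l] Q[of j l] l by (intro mult_nonpos_nonneg) auto
        qed
        then show ?thesis
          by (subst R_rec[OF False]) (simp add: True sqcoeff_uminus sqcoeff_sqvar_mult sqcoeff_sum
              sqcoeff_of_real_mult sum_nonpos)
      next
        case notin: False
        show ?thesis
          by (subst R_rec[OF False]) (simp add: notin sqcoeff_uminus sqcoeff_sqvar_mult)
      qed
    qed
  qed
  have "det M = det (\<chi> j. if j = i then axis i 1 + sqvar i *s q i else M $ j)"
    by (rule arg_cong[where f = det]) (simp add: vec_eq_iff M)
  also have "\<dots> = C i + sqvar i * (\<Sum>l\<in>UNIV. of_real (Q $ i $ l) * C l)"
    by (simp add: det_row_add det_row_mul expand[of "q i"] q_def flip: C_def)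
  finally have "sqcumulant S (det M)
      = sqcoeff ((\<Sum>l\<in>UNIV. of_real (Q $ i $ l) * C l) * c) (S - {i})"
    by (simp add: cumulant)
  also have "\<dots> = (\<Sum>l\<in>UNIV. Q $ i $ l * sqcoeff (R l) (S - {i}))"
    by (simp add: sum_distrib_right sqcoeff_sum sqcoeff_of_real_mult R_def mult.assoc)
  also have "\<dots> \<le> 0"
  proof (rule sum_nonpos)
    fix l
    \<comment> \<open>Here \<open>card S \<ge> 2\<close> enters: \<open>R i = 1\<close> has
      coefficient 0 at a nonempty set, which removes the diagonal term.\<close>
    have "S - {i} \<noteq> {}"
      using S i by (metis Diff_eq_empty_iff One_nat_def Suc_1 card.empty card_mono card_1_singleton_iff
          empty_iff finite_insert finite not_less_eq_eq)
    then have "sqcoeff (R i) (S - {i}) = 0"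
      by (simp add: R_def c sqcoeff_one)
    then show "Q $ i $ l * sqcoeff (R l) (S - {i}) \<le> 0"
      using Q[of i l] R_nonneg[of l "S - {i}"] by (cases "l = i") (auto intro: mult_nonpos_nonneg)
  qed
  finally show ?thesis
    unfolding M_def .
qed

section \<open>Positive semidefiniteness and principal minors\<close>

text \<open>The unit rows outside \<open>S\<close> reduce the determinant to the principal minor on
  \<open>S\<close>.\<close>

lemma principal_minor_nonneg:
  fixes Q :: "real ^ 'n ^ 'n::finite"
  assumes Q: "\<And>x. x \<bullet> (Q *v x) \<ge> 0"
  shows "det (\<chi> j. if j \<in> S then Q $ j else axis j 1) \<ge> 0"
proof (rule ccontr)
  \<comment> \<open>The homotopy is nonsingular for \<open>s < 1\<close>, so its determinant cannot change sign.\<close>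
  define A :: "real \<Rightarrow> real ^ 'n ^ 'n"
    where "A s = (\<chi> j. if j \<in> S then (1 - s) *\<^sub>R axis j 1 + s *\<^sub>R Q $ j else axis j 1)" for s
  assume "\<not> ?thesis"
  then have neg: "det (A 1) \<le> 0" "det (A 1) \<noteq> 0"
    by (simp_all add: A_def cong: if_cong)
  have "A 0 = mat 1"
    by (auto simp: A_def vec_eq_iff mat_def axis_def)
  then have pos: "0 \<le> det (A 0)"
    by simp
  have "continuous_on {0..1} (\<lambda>s. A s $ j $ l)" for j l
    by (cases "j \<in> S") (auto simp: A_def intro!: continuous_intros)
  then have "continuous_on {0..1} (\<lambda>s. det (A s))"
    unfolding det_def by (intro continuous_on_sum continuous_on_mult continuous_on_const continuous_on_prod)
  then obtain s where s: "0 \<le> s" "s \<le> 1" "det (A s) = 0"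
    using IVT2'[of "\<lambda>s. det (A s)" 1 0 0] neg pos by auto
  then have s1: "s < 1"
    using neg by (cases "s = 1") auto
  obtain x where x: "A s *v x = 0" "x \<noteq> 0"
    using s(3) by (metis invertible_det_nz invertible_left_inverse matrix_left_invertible_ker)
  have Ax: "(A s *v x) $ j = (if j \<in> S then (1 - s) * x $ j + s * (Q *v x) $ j else x $ j)" for j
  proof -
    have row: "(A s *v x) $ j = A s $ j \<bullet> x"
      by (simp add: matrix_vector_mult_def inner_vec_def)
    have "Q $ j \<bullet> x = (Q *v x) $ j"
      by (simp add: matrix_vector_mult_def inner_vec_def)
    then show ?thesis
      unfolding row by (simp add: A_def inner_left_distrib inner_axis')
  qed
  \<comment> \<open>Outside \<open>S\<close> the kernel equation says \<open>x $ j = 0\<close>, so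
    after multiplication by \<open>x $ j\<close> the sum may run over all indices.\<close>
  have "x $ j * ((1 - s) * x $ j + s * (Q *v x) $ j) = 0" for j
    using Ax[of j] x(1) by (auto split: if_splits)
  then have "0 = (\<Sum>j\<in>UNIV. x $ j * ((1 - s) * x $ j + s * (Q *v x) $ j))"
    by (simp only: sum.neutral_const)
  also have "\<dots> = (1 - s) * (x \<bullet> x) + s * (x \<bullet> (Q *v x))"
    by (simp add: inner_vec_def algebra_simps sum.distrib sum_distrib_left sum_subtractf)
  finally have "(1 - s) * (x \<bullet> x) + s * (x \<bullet> (Q *v x)) = 0" ..
  moreover have "(1 - s) * (x \<bullet> x) > 0" "s * (x \<bullet> (Q *v x)) \<ge> 0"
    using s s1 x(2) Q[of x] by auto
  ultimately show False
    by linarith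
qed

text \<open>Twice the quadratic form is the sum of the squared differences of \<open>x\<close> over
  ordered pairs of adjacent vertices.\<close>

lemma laplacian_psd:
  fixes E :: "'n::finite \<Rightarrow> 'n \<Rightarrow> bool"
  assumes "symp E"
  shows "x \<bullet> (laplacian E *v x) \<ge> 0"
proof -
  define a where "a i j = (if E i j then 1 else 0 :: real)" for i j
  have a_sym: "a i j = a j i" for i j
    using assms by (auto simp: a_def dest: sympD)
  have deg: "real (vertex_degree E i) = (\<Sum>j\<in>UNIV. a i j)" for i
    by (simp add: a_def vertex_degree_def sum.If_cases)
  have "(laplacian E *v x) $ i = (\<Sum>j\<in>UNIV. a i j * (x $ i - x $ j))" for i
  proof -
    have "(laplacian E *v x) $ i
        = (\<Sum>j\<in>UNIV. (if i = j then real (vertex_degree E i) * x $ i else 0) - a i j * x $ j)"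
      unfolding matrix_vector_mult_def
      by (auto simp: laplacian_def diag_matrix_def adjacency_matrix_def a_def algebra_simps
          intro!: sum.cong)
    also have "\<dots> = (\<Sum>j\<in>UNIV. a i j * (x $ i - x $ j))"
      by (simp add: sum_subtractf deg right_diff_distrib sum_distrib_right)
    finally show ?thesis .
  qed
  then have quad: "x \<bullet> (laplacian E *v x) = (\<Sum>i\<in>UNIV. \<Sum>j\<in>UNIV. a i j * (x $ i * (x $ i - x $ j)))"
    by (simp add: inner_vec_def sum_distrib_left mult.left_commute)
  \<comment> \<open>Adding the double sum with \<open>i\<close> and \<open>j\<close> swapped
    completes the square.\<close>
  moreover have "(\<Sum>i\<in>UNIV. \<Sum>j\<in>UNIV. a i j * (x $ i * (x $ i - x $ j)))
      = (\<Sum>i\<in>UNIV. \<Sum>j\<in>UNIV. a i j * (x $ j * (x $ j - x $ i)))"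
    by (subst sum.swap) (simp add: a_sym)
  ultimately have "2 * (x \<bullet> (laplacian E *v x))
      = (\<Sum>i\<in>UNIV. \<Sum>j\<in>UNIV. a i j * (x $ i * (x $ i - x $ j)) + a i j * (x $ j * (x $ j - x $ i)))"
    by (simp add: sum.distrib)
  also have "\<dots> = (\<Sum>i\<in>UNIV. \<Sum>j\<in>UNIV. a i j * (x $ i - x $ j)\<^sup>2)"
    by (intro sum.cong refl) (simp add: power2_eq_square algebra_simps)
  also have "\<dots> \<ge> 0"
    by (intro sum_nonneg) (simp add: a_def)
  finally show ?thesis
    by simp
qed

theorem corollary6p6:
  fixes E :: "'n::finite \<Rightarrow> 'n \<Rightarrow> bool"
  assumes "simple_graph E"
  shows "det (mat 1 + diag_matrix sqvar ** of_real_matrix (laplacian E) :: 'n sqfree ^ 'n ^ 'n)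
    \<in> LC"
proof -
  let ?M = "mat 1 + diag_matrix sqvar ** of_real_matrix (laplacian E) :: 'n sqfree ^ 'n ^ 'n"
  have mat_1: "(\<chi> j. axis j 1) = (mat 1 :: real ^ 'n ^ 'n)"
    by (auto simp: vec_eq_iff mat_def axis_def)
  \<comment> \<open>Writing the identity by rows \<open>axis j 1\<close> gives the coefficients the
    form of \<open>principal_minor_nonneg\<close>.\<close>
  have "?M = (\<chi> j l. of_real ((\<chi> j. axis j 1) $ j $ l) + sqvar j * of_real (laplacian E $ j $ l))"
    unfolding mat_1
    by (auto simp: vec_eq_iff mat_def matrix_matrix_mult_def diag_matrix_def
        of_real_matrix_def if_distrib[of "\<lambda>x. x * _"] cong: if_cong)
  then have coeff: "sqcoeff (det ?M) S = det (\<chi> j. if j \<in> S then laplacian E $ j else axis j 1)" for S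
    by (simp only: sqcoeff_det_affine) (simp cong: if_cong)
  have "x \<bullet> (laplacian E *v x) \<ge> 0" for x
    using assms by (intro laplacian_psd) (simp add: simple_graph_def)
  then have "sqcoeff (det ?M) S \<ge> 0" for S
    unfolding coeff by (rule principal_minor_nonneg)
  moreover have "sqcoeff (det ?M) {} = 1"
    by (simp add: coeff mat_1)
  moreover have "sqcumulant S (det ?M) \<le> 0" if "card S \<ge> 2" for S
    using that by (intro sqcumulant_det_nonpos)
      (auto simp: laplacian_def diag_matrix_def adjacency_matrix_def)
  ultimately show ?thesis
    by (simp add: LC_def)
qed

end
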